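(* Let $n$ be a positive integer and let $G$ be a non-abelian (possibly infinite) $n$-centralizer F-group. Then $\gcd\left(n-2, \left|\frac{G}{Z(G)}\right|\right) \neq 1$.
   Context: For a group $G$ and $x\in G$, $C(x)$ is the centralizer of $x$ in $G$, and $\mathrm{Cent}(G)=\{C(x) : x\in G\}$. $G$ is $n$-centralizer if $|\mathrm{Cent}(G)|=n$. $Z(G)$ is the center of $G$. $G$ is an F-group if for all $x,y\in G\setminus Z(G)$, $C(x)\leq C(y)$ implies $C(x)=C(y)$. *)

theory Defs
  imports "HOL-Algebra.Coset"
begin

definition centralizer :: "('a, 'b) monoid_scheme \<Rightarrow> 'a \<Rightarrow> 'a set" where
  "centralizer G x = {g \<in> carrier G. g \<otimes>\<^bsub>G\<^esub> x = x \<otimes>\<^bsub>G\<^esub> g}"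

definition center :: "('a, 'b) monoid_scheme \<Rightarrow> 'a set" where
  "center G = {z \<in> carrier G. \<forall>g \<in> carrier G. z \<otimes>\<^bsub>G\<^esub> g = g \<otimes>\<^bsub>G\<^esub> z}"

definition Cent :: "('a, 'b) monoid_scheme \<Rightarrow> 'a set set" where
  "Cent G = {centralizer G x | x. x \<in> carrier G}"

(* Finiteness is explicit because card is 0 on infinite sets. *)
definition n_centralizer :: "nat \<Rightarrow> ('a, 'b) monoid_scheme \<Rightarrow> bool" where
  "n_centralizer n G \<longleftrightarrow> finite (Cent G) \<and> card (Cent G) = n"

definition F_group :: "('a, 'b) monoid_scheme \<Rightarrow> bool" where
  "F_group G \<longleftrightarrow> group G \<and>
     (\<forall>x \<in> carrier G - center G. \<forall>y \<in> carrier G - center G.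
        centralizer G x \<subseteq> centralizer G y \<longrightarrow> centralizer G x = centralizer G y)"

lemma center_normal:
  assumes "group G"
  shows "center G \<lhd> G"
proof -
  interpret group G by fact
  have "subgroup (center G) G"
  proof (rule subgroupI)
    show "center G \<subseteq> carrier G" by (auto simp: center_def)
    have "\<one>\<^bsub>G\<^esub> \<in> center G" by (simp add: center_def)
    then show "center G \<noteq> {}" by blast
  next
    fix a assume a: "a \<in> center G"
    have "inv\<^bsub>G\<^esub> a \<otimes>\<^bsub>G\<^esub> g = g \<otimes>\<^bsub>G\<^esub> inv\<^bsub>G\<^esub> a" if g: "g \<in> carrier G" for g
    proof -
      have c: "a \<otimes>\<^bsub>G\<^esub> inv\<^bsub>G\<^esub> g = inv\<^bsub>G\<^esub> g \<otimes>\<^bsub>G\<^esub> a" "a \<in> carrier G"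
        using a g by (simp_all add: center_def)
      have "inv\<^bsub>G\<^esub> (inv\<^bsub>G\<^esub> g \<otimes>\<^bsub>G\<^esub> a) = inv\<^bsub>G\<^esub> (a \<otimes>\<^bsub>G\<^esub> inv\<^bsub>G\<^esub> g)"
        using c by simp
      then show ?thesis
        using g c(2) by (simp add: inv_mult_group)
    qed
    then show "inv\<^bsub>G\<^esub> a \<in> center G" using a by (simp add: center_def)
  next
    fix a b assume ab: "a \<in> center G" "b \<in> center G"
    have "a \<otimes>\<^bsub>G\<^esub> b \<otimes>\<^bsub>G\<^esub> g = g \<otimes>\<^bsub>G\<^esub> (a \<otimes>\<^bsub>G\<^esub> b)" if g: "g \<in> carrier G" for g
    proof -
      have c: "a \<in> carrier G" "b \<in> carrier G" using ab unfolding center_def by blast+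
      have "a \<otimes>\<^bsub>G\<^esub> b \<otimes>\<^bsub>G\<^esub> g = a \<otimes>\<^bsub>G\<^esub> (b \<otimes>\<^bsub>G\<^esub> g)" using c g by (rule m_assoc)
      also have "b \<otimes>\<^bsub>G\<^esub> g = g \<otimes>\<^bsub>G\<^esub> b" using ab g unfolding center_def by blast
      also have "a \<otimes>\<^bsub>G\<^esub> (g \<otimes>\<^bsub>G\<^esub> b) = (a \<otimes>\<^bsub>G\<^esub> g) \<otimes>\<^bsub>G\<^esub> b" using c g by (simp add: m_assoc)
      also have "a \<otimes>\<^bsub>G\<^esub> g = g \<otimes>\<^bsub>G\<^esub> a" using ab g unfolding center_def by blast
      also have "g \<otimes>\<^bsub>G\<^esub> a \<otimes>\<^bsub>G\<^esub> b = g \<otimes>\<^bsub>G\<^esub> (a \<otimes>\<^bsub>G\<^esub> b)" using c g by (simp add: m_assoc)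
      finally show ?thesis .
    qed
    then show "a \<otimes>\<^bsub>G\<^esub> b \<in> center G"
      using ab unfolding center_def by blast
  qed
  moreover have "x \<otimes>\<^bsub>G\<^esub> h \<otimes>\<^bsub>G\<^esub> inv\<^bsub>G\<^esub> x \<in> center G" if "x \<in> carrier G" "h \<in> center G" for x h
  proof -
    have h: "h \<in> carrier G" and c: "h \<otimes>\<^bsub>G\<^esub> x = x \<otimes>\<^bsub>G\<^esub> h"
      using that unfolding center_def by blast+
    have "x \<otimes>\<^bsub>G\<^esub> h \<otimes>\<^bsub>G\<^esub> inv\<^bsub>G\<^esub> x = h \<otimes>\<^bsub>G\<^esub> x \<otimes>\<^bsub>G\<^esub> inv\<^bsub>G\<^esub> x"
      by (simp only: c)
    also have "\<dots> = h"
      using h that(1) by (simp add: m_assoc)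
    finally have "x \<otimes>\<^bsub>G\<^esub> h \<otimes>\<^bsub>G\<^esub> inv\<^bsub>G\<^esub> x = h" .
    then show ?thesis using that(2) by simp
  qed
  ultimately show ?thesis unfolding normal_inv_iff by blast
qed

end

theory Submission
  imports Defs "HOL-Algebra.Group_Action" "HOL-Algebra.Sylow" "HOL-Algebra.Multiplicative_Group"
begin

text \<open>
  Let \<open>Z\<close> be the center of \<open>G\<close>. In an F-group the centers of distinct proper element centralizers
  meet exactly in \<open>Z\<close>: a noncentral \<open>y\<close> in the center of \<open>C(x)\<close> satisfies
  \<open>C(x) \<subseteq> C(y)\<close>, hence \<open>C(x) = C(y)\<close>. Their images therefore partition \<open>G/Z\<close> into \<open>n - 1\<close>
  nontrivial abelian subgroups that conjugation permutes (\<open>F_group_quotient_partition\<close>). The claim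
  becomes one about such a partition of a group with \<open>m \<ge> 2\<close> parts: the group is finite, and
  some prime divides both its order and \<open>m - 1\<close>.

  Finiteness: for \<open>g\<close> outside a part \<open>A\<close>, two elements of the coset \<open>g A\<close> cannot share a part, so
  \<open>A\<close> has at most \<open>m\<close> elements (\<open>finite_part\<close>).

  For the prime, write \<open>A[p]\<close> for the elements of \<open>A\<close> with \<open>p\<close>-th power \<open>\<one>\<close>, and choose the
  pair \<open>(A, p)\<close> such that \<open>Q = A[p]\<close> has the largest possible order. The \<open>p\<close>-group \<open>Q\<close> acts by
  conjugation on the \<open>m - 1\<close> parts other than \<open>A\<close>, so it suffices to show that the number of parts
  \<open>B\<close> that \<open>Q\<close> normalizes is divisible by \<open>p\<close>. Commuting nontrivial elements of different parts have the
  same exponents (\<open>commuting_parts_exponent\<close>), and this has two consequences.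

  First, if \<open>Q\<close> normalizes \<open>B\<close>, it centralizes some nontrivial element of \<open>B\<close>. When \<open>B[p]\<close> is
  nontrivial this is the fixed point of a \<open>p\<close>-group acting on a \<open>p\<close>-group. Otherwise no
  nontrivial element of \<open>Q\<close> fixes a nontrivial element of \<open>B\<close>; as some \<open>B[r]\<close> is nontrivial, its
  elements other than \<open>\<one>\<close> form regular orbits under \<open>Q\<close>, so \<open>B[r]\<close> is larger than \<open>Q\<close>, against the choice of \<open>Q\<close>
  (\<open>normalizing_torsion_fixes_element\<close>).

  Second, the centralizer \<open>C\<close> of \<open>Q\<close> is partitioned by \<open>A\<close> and by the intersections of \<open>C\<close> with those
  \<open>B\<close>, which have exponent \<open>p\<close>. Since \<open>p\<close> divides the orders of \<open>C\<close>, of \<open>A\<close> and of these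
  intersections, counting the elements of \<open>C\<close> outside \<open>A\<close> shows that \<open>p\<close> divides the number of the \<open>B\<close>
  (\<open>prime_dvd_card_parts_meeting_centralizer\<close>).
\<close>

section \<open>Actions of groups of prime exponent\<close>

context group
begin

text \<open>
  The elements of \<^term>\<open>BijGroup E\<close> are undefined outside \<open>E\<close>; hence the restriction.
\<close>
lemma group_actionI:
  assumes closed: "\<And>g x. g \<in> carrier G \<Longrightarrow> x \<in> E \<Longrightarrow> f g x \<in> E"
    and one: "\<And>x. x \<in> E \<Longrightarrow> f \<one> x = x"
    and mult: "\<And>g h x. g \<in> carrier G \<Longrightarrow> h \<in> carrier G \<Longrightarrow> x \<in> E \<Longrightarrow> f (g \<otimes> h) x = f g (f h x)"
  shows "group_action G E (\<lambda>g. \<lambda>x\<in>E. f g x)"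
proof -
  have bij: "(\<lambda>x\<in>E. f g x) \<in> Bij E" if g: "g \<in> carrier G" for g
  proof -
    have "bij_betw (f g) E E"
    proof (rule bij_betw_byWitness[where f' = "f (inv g)"])
      show "\<forall>x\<in>E. f (inv g) (f g x) = x" "\<forall>x\<in>E. f g (f (inv g) x) = x"
        using g mult[symmetric] one by simp_all
      show "f g ` E \<subseteq> E" "f (inv g) ` E \<subseteq> E"
        using g closed by auto
    qed
    then have "bij_betw (\<lambda>x\<in>E. f g x) E E"
      by (simp cong: bij_betw_cong)
    then show ?thesis
      by (simp add: Bij_def)
  qed
  have "(\<lambda>g. \<lambda>x\<in>E. f g x) \<in> hom G (BijGroup E)"
  proof (rule homI)
    show "(\<lambda>x\<in>E. f g x) \<in> carrier (BijGroup E)" if "g \<in> carrier G" for g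
      using bij[OF that] by (simp add: BijGroup_def)
    show "(\<lambda>x\<in>E. f (g \<otimes> h) x) = (\<lambda>x\<in>E. f g x) \<otimes>\<^bsub>BijGroup E\<^esub> (\<lambda>x\<in>E. f h x)"
      if "g \<in> carrier G" "h \<in> carrier G" for g h
      using that bij closed mult by (auto simp: BijGroup_def compose_def fun_eq_iff)
  qed
  then show ?thesis
    by (simp add: group_action_def group_hom_def group_hom_axioms_def group_BijGroup is_group)
qed

text \<open>
  The orbits of the moved points are nontrivial and their sizes divide a power of \<open>p\<close>.
\<close>
lemma p_group_prime_dvd_card_moved:
  assumes "prime p" and order: "order G = p ^ k" and "finite E"
    and closed: "\<And>g x. g \<in> carrier G \<Longrightarrow> x \<in> E \<Longrightarrow> f g x \<in> E"
    and one: "\<And>x. x \<in> E \<Longrightarrow> f \<one> x = x"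
    and mult: "\<And>g h x. g \<in> carrier G \<Longrightarrow> h \<in> carrier G \<Longrightarrow> x \<in> E \<Longrightarrow> f (g \<otimes> h) x = f g (f h x)"
  shows "p dvd card {x \<in> E. \<exists>g\<in>carrier G. f g x \<noteq> x}"
proof -
  define \<phi> where "\<phi> = (\<lambda>g. \<lambda>x\<in>E. f g x)"
  interpret group_action G E \<phi>
    unfolding \<phi>_def using closed one mult by (rule group_actionI)
  define M where "M = {x \<in> E. \<exists>g\<in>carrier G. f g x \<noteq> x}"
  have orb: "orbit G \<phi> x = (\<lambda>g. f g x) ` carrier G" if "x \<in> E" for x
    using that by (auto simp: orbit_def \<phi>_def)
  have dvd: "p dvd card (orbit G \<phi> x)" if x: "x \<in> M" for x
  proof -
    have xE: "x \<in> E" using x by (simp add: M_def)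
    obtain g where g: "g \<in> carrier G" "f g x \<noteq> x" using x by (auto simp: M_def)
    have sub: "orbit G \<phi> x \<subseteq> E" using orb[OF xE] closed[OF _ xE] by auto
    have "card (orbit G \<phi> x) \<noteq> 1"
    proof
      assume "card (orbit G \<phi> x) = 1"
      then obtain y where "orbit G \<phi> x = {y}" by (auto simp: card_1_singleton_iff)
      moreover have "x \<in> orbit G \<phi> x" using xE by (rule orbit_refl)
      moreover have "f g x \<in> orbit G \<phi> x" using g orb[OF xE] by blast
      ultimately show False using g by auto
    qed
    moreover have "card (orbit G \<phi> x) dvd p ^ k"
      using orbit_stabilizer_theorem[OF xE] order by (metis dvd_triv_left)
    ultimately obtain i where "i \<noteq> 0" "card (orbit G \<phi> x) = p ^ i"
      using \<open>prime p\<close> by (metis divides_primepow_nat power_0)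
    then show ?thesis by (simp add: dvd_power)
  qed
  have stays: "orbit G \<phi> x \<subseteq> M" if x: "x \<in> M" for x
  proof
    fix y assume y: "y \<in> orbit G \<phi> x"
    have xE: "x \<in> E" using x by (simp add: M_def)
    have yE: "y \<in> E" using y orb[OF xE] closed[OF _ xE] by auto
    have xy: "x \<in> orbit G \<phi> y" using orbit_sym[OF xE yE y] .
    show "y \<in> M"
    proof (rule ccontr)
      assume "y \<notin> M"
      then have fix_y: "f g y = y" if "g \<in> carrier G" for g using that yE by (auto simp: M_def)
      then have "x = y" using xy orb[OF yE] by auto
      then show False using \<open>y \<notin> M\<close> x by simp
    qed
  qed
  have "M = \<Union> (orbit G \<phi> ` M)"
    using stays orbit_refl by (auto simp: M_def)
  moreover have "p dvd card (\<Union> (orbit G \<phi> ` M))"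
  proof (rule dvd_partition)
    show "finite (\<Union> (orbit G \<phi> ` M))"
      using stays \<open>finite E\<close>
      by (metis (no_types, lifting) M_def UN_subset_iff finite_subset mem_Collect_eq subsetI)
    show "\<forall>c\<in>orbit G \<phi> ` M. p dvd card c" using dvd by blast
    show "\<forall>c1\<in>orbit G \<phi> ` M. \<forall>c2\<in>orbit G \<phi> ` M. c1 \<noteq> c2 \<longrightarrow> c1 \<inter> c2 = {}"
    proof (intro ballI impI)
      fix c1 c2 assume "c1 \<in> orbit G \<phi> ` M" "c2 \<in> orbit G \<phi> ` M" "c1 \<noteq> c2"
      then show "c1 \<inter> c2 = {}"
        using disjoint_union[of c1 c2] by (auto simp: orbits_def M_def)
    qed
  qed
  ultimately show ?thesis unfolding M_def by simp
qed

lemma subgroup_nat_pow_closed: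
  assumes "subgroup S G" "x \<in> S"
  shows "x [^] (n::nat) \<in> S"
  using assms by (induction n) (simp_all add: subgroup.one_closed subgroup.m_closed)

lemma eq_one_if_coprime_exponents:
  assumes "x \<in> carrier G" "x [^] (p::nat) = \<one>" "x [^] (q::nat) = \<one>" "coprime p q"
  shows "x = \<one>"
proof -
  have "ord x dvd p" "ord x dvd q" using assms by (simp_all add: pow_eq_id)
  then have "ord x = 1" using \<open>coprime p q\<close> by (metis coprime_common_divisor_nat)
  then show ?thesis using ord_eq_1 assms(1) by blast
qed

text \<open>
  A second prime \<open>s\<close> dividing the order would give, by Sylow's theorem, a subgroup of order \<open>s\<close>, whose
  elements have the coprime exponents \<open>p\<close> and \<open>s\<close>.
\<close>
lemma order_of_prime_exponent_group:
  assumes "prime p" "finite (carrier G)" and exp: "\<And>x. x \<in> carrier G \<Longrightarrow> x [^] p = \<one>"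
  shows "\<exists>k. order G = p ^ k"
proof -
  have pos: "order G \<noteq> 0" using assms(2) order_gt_0_iff_finite by simp
  obtain m where m: "order G = p ^ multiplicity p (order G) * m" "\<not> p dvd m"
    using multiplicity_decompose'[OF pos, of p] \<open>prime p\<close> by (metis mult.commute not_prime_unit)
  have "m = 1"
  proof (rule ccontr)
    assume "m \<noteq> 1"
    then obtain s where s: "prime s" "s dvd m" using prime_factor_nat by blast
    then have "s dvd order G" using m by (metis dvd_mult)
    then obtain t where "order G = s ^ 1 * t" by (auto elim: dvdE)
    then obtain S where S: "subgroup S G" "card S = s ^ 1"
      using sylow_thm[OF \<open>prime s\<close> is_group _ assms(2)] by blast
    have "S \<noteq> {\<one>}" using S(2) s(1) by auto
    then obtain x where x: "x \<in> S" "x \<noteq> \<one>" using subgroup.one_closed[OF S(1)] by blast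
    then have xG: "x \<in> carrier G" using subgroup.mem_carrier[OF S(1)] by blast
    interpret S: group "G\<lparr>carrier := S\<rparr>" using S(1) by (rule subgroup.subgroup_is_group) (rule is_group)
    have "x [^]\<^bsub>G\<lparr>carrier := S\<rparr>\<^esub> order (G\<lparr>carrier := S\<rparr>) = \<one>\<^bsub>G\<lparr>carrier := S\<rparr>\<^esub>"
      using x(1) by (intro S.pow_order_eq_1) simp
    then have "x [^] s = \<one>" using S(2) by (simp add: order_def nat_pow_consistent[symmetric])
    moreover have "coprime p s" using s m(2) \<open>prime p\<close> primes_coprime by blast
    ultimately show False using eq_one_if_coprime_exponents[OF xG exp[OF xG]] x(2) by blast
  qed
  then show ?thesis using m(1) by auto
qed

lemma subgroup_prime_exponent_card:
  assumes "prime p" "subgroup S G" "finite S" "\<And>x. x \<in> S \<Longrightarrow> x [^] p = \<one>"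
  shows "\<exists>k. card S = p ^ k"
proof -
  interpret S: group "G\<lparr>carrier := S\<rparr>" using assms(2) by (rule subgroup.subgroup_is_group) (rule is_group)
  show ?thesis
    using S.order_of_prime_exponent_group[OF assms(1)] assms(3,4)
    by (simp add: order_def nat_pow_consistent[symmetric])
qed

lemma subgroup_prime_exponent_dvd_card:
  assumes "prime p" "subgroup S G" "finite S" "\<And>x. x \<in> S \<Longrightarrow> x [^] p = \<one>" "S \<noteq> {\<one>}"
  shows "p dvd card S"
proof -
  obtain k where k: "card S = p ^ k" using subgroup_prime_exponent_card[OF assms(1-4)] by blast
  have "k \<noteq> 0"
  proof
    assume "k = 0"
    then obtain y where "S = {y}" using k by (auto simp: card_1_singleton_iff)
    then show False using subgroup.one_closed[OF assms(2)] assms(5) by auto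
  qed
  then show ?thesis using k by (simp add: dvd_power)
qed

lemma subgroup_prime_exponent_dvd_card_moved:
  assumes "prime p" "subgroup Q G" "finite Q" "\<And>g. g \<in> Q \<Longrightarrow> g [^] p = \<one>" and "finite E"
    and "\<And>g x. g \<in> Q \<Longrightarrow> x \<in> E \<Longrightarrow> f g x \<in> E"
    and "\<And>x. x \<in> E \<Longrightarrow> f \<one> x = x"
    and "\<And>g h x. g \<in> Q \<Longrightarrow> h \<in> Q \<Longrightarrow> x \<in> E \<Longrightarrow> f (g \<otimes> h) x = f g (f h x)"
  shows "p dvd card {x \<in> E. \<exists>g\<in>Q. f g x \<noteq> x}"
proof -
  obtain k where k: "card Q = p ^ k" using subgroup_prime_exponent_card[OF assms(1-4)] by blast
  interpret Q: group "G\<lparr>carrier := Q\<rparr>" using assms(2) by (rule subgroup.subgroup_is_group) (rule is_group)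
  have "p dvd card {x \<in> E. \<exists>g\<in>carrier (G\<lparr>carrier := Q\<rparr>). f g x \<noteq> x}"
    using k assms(5-8)
    by (intro Q.p_group_prime_dvd_card_moved[OF assms(1), of k]) (simp_all add: order_def)
  then show ?thesis by simp
qed

lemma subgroup_has_prime_order_element:
  assumes "subgroup S G" "finite S" "S \<noteq> {\<one>}"
  obtains p x where "prime p" "x \<in> S" "x \<noteq> \<one>" "x [^] (p::nat) = \<one>"
proof -
  obtain y where y: "y \<in> S" "y \<noteq> \<one>" using assms(3) subgroup.one_closed[OF assms(1)] by blast
  then have yG: "y \<in> carrier G" using subgroup.mem_carrier[OF assms(1)] by blast
  interpret S: group "G\<lparr>carrier := S\<rparr>" using assms(1) by (rule subgroup.subgroup_is_group) (rule is_group)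
  have "y [^]\<^bsub>G\<lparr>carrier := S\<rparr>\<^esub> order (G\<lparr>carrier := S\<rparr>) = \<one>\<^bsub>G\<lparr>carrier := S\<rparr>\<^esub>"
    using y(1) by (intro S.pow_order_eq_1) simp
  then have "y [^] card S = \<one>" by (simp add: order_def nat_pow_consistent[symmetric])
  then have "ord y dvd card S" using yG by (simp add: pow_eq_id)
  moreover have "card S \<noteq> 0" using assms(2) y(1) by auto
  ultimately have "ord y \<noteq> 0" by auto
  moreover have "ord y \<noteq> 1" using ord_eq_1[OF yG] y(2) by blast
  ultimately obtain p where p: "prime p" "p dvd ord y" using prime_factor_nat by blast
  then obtain t where t: "ord y = p * t" by (auto elim: dvdE)
  have "t \<noteq> 0" using t \<open>ord y \<noteq> 0\<close> by auto
  show thesis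
  proof (rule that)
    show "prime p" by fact
    show "y [^] t \<in> S"
      using subgroup_nat_pow_closed[OF assms(1) y(1)] .
    show "y [^] t \<noteq> \<one>"
    proof
      assume "y [^] t = \<one>"
      then have "p * t dvd t" using yG t by (simp add: pow_eq_id)
      then show False using \<open>t \<noteq> 0\<close> p(1) by simp
    qed
    show "(y [^] t) [^] p = \<one>" using yG pow_ord_eq_1[of y] t by (simp add: nat_pow_pow mult.commute)
  qed
qed

end

section \<open>Conjugation and centralizers of sets\<close>

definition conjugate :: "('a, 'b) monoid_scheme \<Rightarrow> 'a \<Rightarrow> 'a \<Rightarrow> 'a" where
  "conjugate G g x = g \<otimes>\<^bsub>G\<^esub> x \<otimes>\<^bsub>G\<^esub> inv\<^bsub>G\<^esub> g"

definition set_centralizer :: "('a, 'b) monoid_scheme \<Rightarrow> 'a set \<Rightarrow> 'a set" where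
  "set_centralizer G S = {g \<in> carrier G. \<forall>s\<in>S. g \<otimes>\<^bsub>G\<^esub> s = s \<otimes>\<^bsub>G\<^esub> g}"

context group
begin

lemma conjugate_closed [simp]:
  "g \<in> carrier G \<Longrightarrow> x \<in> carrier G \<Longrightarrow> conjugate G g x \<in> carrier G"
  by (simp add: conjugate_def)

lemma conjugate_by_one [simp]: "x \<in> carrier G \<Longrightarrow> conjugate G \<one> x = x"
  by (simp add: conjugate_def)

lemma conjugate_by_mult:
  "g \<in> carrier G \<Longrightarrow> h \<in> carrier G \<Longrightarrow> x \<in> carrier G \<Longrightarrow>
    conjugate G (g \<otimes> h) x = conjugate G g (conjugate G h x)"
  by (simp add: conjugate_def m_assoc inv_mult_group)

lemma conjugate_one [simp]: "g \<in> carrier G \<Longrightarrow> conjugate G g \<one> = \<one>"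
  by (simp add: conjugate_def)

lemma conjugate_mult:
  assumes "g \<in> carrier G" "x \<in> carrier G" "y \<in> carrier G"
  shows "conjugate G g (x \<otimes> y) = conjugate G g x \<otimes> conjugate G g y"
proof -
  have "inv g \<otimes> (g \<otimes> (y \<otimes> inv g)) = y \<otimes> inv g"
    using assms by (simp add: m_assoc[symmetric])
  then show ?thesis using assms by (simp add: conjugate_def m_assoc)
qed

lemma conjugate_inv_conjugate [simp]:
  "g \<in> carrier G \<Longrightarrow> x \<in> carrier G \<Longrightarrow> conjugate G (inv g) (conjugate G g x) = x"
  "g \<in> carrier G \<Longrightarrow> x \<in> carrier G \<Longrightarrow> conjugate G g (conjugate G (inv g) x) = x"
  by (simp_all add: conjugate_by_mult[symmetric])

lemma conjugate_eq_one_iff [simp]: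
  assumes "g \<in> carrier G" "x \<in> carrier G"
  shows "conjugate G g x = \<one> \<longleftrightarrow> x = \<one>"
  using conjugate_inv_conjugate(1)[OF assms] assms by (metis conjugate_one inv_closed)

lemma conjugate_eq_self_iff:
  assumes "g \<in> carrier G" "x \<in> carrier G"
  shows "conjugate G g x = x \<longleftrightarrow> g \<otimes> x = x \<otimes> g"
  using assms by (metis conjugate_def inv_closed inv_solve_right m_closed)

lemma commute_inv:
  assumes "g \<in> carrier G" "x \<in> carrier G" "g \<otimes> x = x \<otimes> g"
  shows "g \<otimes> inv x = inv x \<otimes> g"
proof -
  have "conjugate G x g = g" using assms by (simp add: conjugate_eq_self_iff)
  then have "conjugate G (inv x) g = g"
    using conjugate_inv_conjugate(1)[of x g] assms by simp
  then show ?thesis using assms by (simp add: conjugate_eq_self_iff)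
qed

lemma commute_mult:
  assumes "g \<in> carrier G" "x \<in> carrier G" "y \<in> carrier G" "g \<otimes> x = x \<otimes> g" "g \<otimes> y = y \<otimes> g"
  shows "g \<otimes> (x \<otimes> y) = x \<otimes> y \<otimes> g"
proof -
  have "g \<otimes> (x \<otimes> y) = x \<otimes> g \<otimes> y" using assms by (simp add: m_assoc[symmetric])
  also have "\<dots> = x \<otimes> y \<otimes> g" using assms by (simp add: m_assoc)
  finally show ?thesis .
qed

lemma set_centralizer_subgroup:
  assumes S: "S \<subseteq> carrier G"
  shows "subgroup (set_centralizer G S) G"
proof (rule subgroupI)
  show "set_centralizer G S \<subseteq> carrier G" by (auto simp: set_centralizer_def)
  have "\<one> \<in> set_centralizer G S" using S by (auto simp: set_centralizer_def)
  then show "set_centralizer G S \<noteq> {}" by blast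
  show "inv x \<in> set_centralizer G S" if "x \<in> set_centralizer G S" for x
  proof -
    have "inv x \<otimes> s = s \<otimes> inv x" if s: "s \<in> S" for s
    proof -
      have "s \<in> carrier G" "x \<in> carrier G" "s \<otimes> x = x \<otimes> s"
        using S s \<open>x \<in> set_centralizer G S\<close> by (auto simp: set_centralizer_def)
      then show ?thesis using commute_inv by simp
    qed
    then show ?thesis using that by (simp add: set_centralizer_def)
  qed
  show "x \<otimes> y \<in> set_centralizer G S" if "x \<in> set_centralizer G S" "y \<in> set_centralizer G S" for x y
  proof -
    have "x \<otimes> y \<otimes> s = s \<otimes> (x \<otimes> y)" if s: "s \<in> S" for s
    proof -
      have "s \<in> carrier G" "x \<in> carrier G" "y \<in> carrier G" "s \<otimes> x = x \<otimes> s" "s \<otimes> y = y \<otimes> s"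
        using S s \<open>x \<in> set_centralizer G S\<close> \<open>y \<in> set_centralizer G S\<close>
        by (auto simp: set_centralizer_def)
      then show ?thesis using commute_mult by simp
    qed
    then show ?thesis using that by (simp add: set_centralizer_def)
  qed
qed

lemma conjugate_commute_iff:
  assumes "g \<in> carrier G" "x \<in> carrier G" "y \<in> carrier G"
  shows "conjugate G g x \<otimes> conjugate G g y = conjugate G g y \<otimes> conjugate G g x \<longleftrightarrow> x \<otimes> y = y \<otimes> x"
  using assms by (metis conjugate_mult conjugate_inv_conjugate(1) m_closed)

lemma conjugate_set_centralizer:
  assumes g: "g \<in> carrier G" and S: "S \<subseteq> carrier G"
  shows "conjugate G g ` set_centralizer G S = set_centralizer G (conjugate G g ` S)"
proof
  show "conjugate G g ` set_centralizer G S \<subseteq> set_centralizer G (conjugate G g ` S)"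
    using g S by (auto simp: set_centralizer_def conjugate_commute_iff subset_iff)
  show "set_centralizer G (conjugate G g ` S) \<subseteq> conjugate G g ` set_centralizer G S"
  proof
    fix a assume a: "a \<in> set_centralizer G (conjugate G g ` S)"
    define b where "b = conjugate G (inv g) a"
    have aG: "a \<in> carrier G" using a by (simp add: set_centralizer_def)
    then have bG: "b \<in> carrier G" and ab: "a = conjugate G g b" using g by (simp_all add: b_def)
    have "b \<otimes> s = s \<otimes> b" if "s \<in> S" for s
      using a that g bG S unfolding ab by (auto simp: set_centralizer_def conjugate_commute_iff subset_iff)
    then show "a \<in> conjugate G g ` set_centralizer G S"
      using ab bG by (auto simp: set_centralizer_def)
  qed
qed

lemma conjugate_pow:
  assumes "g \<in> carrier G" "x \<in> carrier G"
  shows "conjugate G g x [^] (n::nat) = conjugate G g (x [^] n)"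
  using assms by (induction n) (simp_all add: conjugate_mult)

end

section \<open>Normal partitions into abelian subgroups\<close>

definition (in group) torsion :: "'a set \<Rightarrow> nat \<Rightarrow> 'a set" where
  "torsion A p = {x \<in> A. x [^] p = \<one>}"

text \<open>
  \<open>parts_ge_2\<close> excludes the partition of an abelian group into a single part, which may be infinite.
\<close>
locale normal_abelian_partition = group G for G (structure) +
  fixes \<P> :: "'a set set"
  assumes finite_parts: "finite \<P>"
    and part_subgroup: "A \<in> \<P> \<Longrightarrow> subgroup A G"
    and part_commute: "A \<in> \<P> \<Longrightarrow> x \<in> A \<Longrightarrow> y \<in> A \<Longrightarrow> x \<otimes> y = y \<otimes> x"
    and part_nontrivial: "A \<in> \<P> \<Longrightarrow> A \<noteq> {\<one>}"
    and parts_cover: "x \<in> carrier G \<Longrightarrow> \<exists>A\<in>\<P>. x \<in> A"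
    and parts_meet: "A \<in> \<P> \<Longrightarrow> B \<in> \<P> \<Longrightarrow> x \<in> A \<Longrightarrow> x \<in> B \<Longrightarrow> x \<noteq> \<one> \<Longrightarrow> A = B"
    and conjugate_part: "A \<in> \<P> \<Longrightarrow> g \<in> carrier G \<Longrightarrow> conjugate G g ` A \<in> \<P>"
    and parts_ge_2: "card \<P> \<ge> 2"
begin

lemma part_carrier: "A \<in> \<P> \<Longrightarrow> x \<in> A \<Longrightarrow> x \<in> carrier G"
  using subgroup.mem_carrier[OF part_subgroup] by blast

text \<open>
  Fix \<open>g\<close> outside \<open>A\<close>. If \<open>g a\<close> and \<open>g b\<close> lie in the same part \<open>C\<close>, then \<open>inv a \<otimes> b\<close> lies in both
  \<open>C\<close> and \<open>A\<close>; as \<open>C = A\<close> would put \<open>g\<close> into \<open>A\<close>, this forces \<open>a = b\<close>. Thus \<open>A\<close> injects into the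
  finite set of parts.
\<close>
lemma finite_part:
  assumes A: "A \<in> \<P>"
  shows "finite A"
proof -
  have "card (\<P> - {A}) \<noteq> 0" using A parts_ge_2 finite_parts by simp
  then obtain B where B: "B \<in> \<P>" "B \<noteq> A" by (metis DiffE card.empty ex_in_conv insertCI)
  obtain g where g: "g \<in> B" "g \<noteq> \<one>"
    using part_nontrivial[OF B(1)] subgroup.one_closed[OF part_subgroup[OF B(1)]] by blast
  have gG: "g \<in> carrier G" using part_carrier[OF B(1) g(1)] .
  have gA: "g \<notin> A" using parts_meet[OF A B(1)] g B(2) by blast
  obtain part where part: "part x \<in> \<P>" "x \<in> part x" if "x \<in> carrier G" for x
    using parts_cover by metis
  have "inj_on (\<lambda>a. part (g \<otimes> a)) A"
  proof (rule inj_onI, rule ccontr)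
    fix a b assume ab: "a \<in> A" "b \<in> A" "part (g \<otimes> a) = part (g \<otimes> b)" "a \<noteq> b"
    define C where "C = part (g \<otimes> a)"
    have abG: "a \<in> carrier G" "b \<in> carrier G" using ab part_carrier[OF A] by blast+
    have C: "C \<in> \<P>" "g \<otimes> a \<in> C" "g \<otimes> b \<in> C"
      using part gG abG ab(3) unfolding C_def by auto
    interpret A: subgroup A G using part_subgroup[OF A] .
    interpret C: subgroup C G using part_subgroup[OF C(1)] .
    have eq: "inv (g \<otimes> a) \<otimes> (g \<otimes> b) = inv a \<otimes> b"
      using gG abG by (simp add: inv_mult_group m_assoc inv_solve_left')
    have "inv a \<otimes> b \<in> C" using C eq by (metis C.m_closed[OF C.m_inv_closed])
    moreover have "inv a \<otimes> b \<in> A" using ab by simp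
    moreover have "inv a \<otimes> b \<noteq> \<one>" using ab(4) abG by (metis inv_comm inv_equality inv_inv inv_closed)
    ultimately have "C = A" using parts_meet C(1) A by blast
    then have "g \<otimes> a \<otimes> inv a \<in> A" using C(2) ab(1) by simp
    then show False using gA gG abG by (simp add: m_assoc)
  qed
  moreover have "(\<lambda>a. part (g \<otimes> a)) ` A \<subseteq> \<P>"
    using part(1) gG part_carrier[OF A] by auto
  ultimately show ?thesis using finite_parts by (metis finite_imageD finite_subset)
qed

lemma finite_carrier: "finite (carrier G)"
proof -
  have "carrier G \<subseteq> \<Union> \<P>" using parts_cover by blast
  then show ?thesis using finite_parts finite_part by (meson finite_Union finite_subset)
qed

text \<open>
  The product \<open>a \<otimes> b\<close> lies in a part different from that of \<open>b\<close>, while its \<open>k\<close>-th power is \<open>b [^] k\<close>.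
\<close>
lemma commuting_parts_exponent:
  assumes A: "A \<in> \<P>" "a \<in> A" "a \<noteq> \<one>" and B: "B \<in> \<P>" "b \<in> B" and "A \<noteq> B"
    and comm: "a \<otimes> b = b \<otimes> a" and exp: "a [^] (k::nat) = \<one>"
  shows "b [^] k = \<one>"
proof (rule ccontr)
  assume neq: "b [^] k \<noteq> \<one>"
  have aG: "a \<in> carrier G" and bG: "b \<in> carrier G" using A B part_carrier by blast+
  obtain C where C: "C \<in> \<P>" "a \<otimes> b \<in> C" using parts_cover aG bG by blast
  have "(a \<otimes> b) [^] k = b [^] k" using pow_mult_distrib[OF comm aG bG] exp bG by simp
  moreover have "(a \<otimes> b) [^] k \<in> C"
    using subgroup_nat_pow_closed[OF part_subgroup[OF C(1)] C(2)] .
  moreover have "b [^] k \<in> B"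
    using subgroup_nat_pow_closed[OF part_subgroup[OF B(1)] B(2)] .
  ultimately have "C = B" using parts_meet C(1) B(1) neq by metis
  interpret B: subgroup B G using part_subgroup[OF B(1)] .
  have "a \<otimes> b \<otimes> inv b \<in> B" using C(2) \<open>C = B\<close> B(2)
    by (simp del: B.m_closed add: B.m_closed[OF _ B.m_inv_closed])
  then have "a \<in> B" using aG bG by (simp add: m_assoc)
  then show False using parts_meet A B(1) \<open>A \<noteq> B\<close> by blast
qed

lemma torsion_subgroup:
  assumes A: "A \<in> \<P>"
  shows "subgroup (torsion A p) G"
proof -
  interpret A: subgroup A G using part_subgroup[OF A] .
  show ?thesis
  proof (rule subgroupI)
    show "torsion A p \<subseteq> carrier G" by (auto simp: torsion_def)
    have "\<one> \<in> torsion A p" by (simp add: torsion_def)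
    then show "torsion A p \<noteq> {}" by blast
    show "inv x \<in> torsion A p" if "x \<in> torsion A p" for x
      using that by (auto simp: torsion_def nat_pow_inv)
    show "x \<otimes> y \<in> torsion A p" if "x \<in> torsion A p" "y \<in> torsion A p" for x y
      using that part_commute[OF A, of x y] by (auto simp: torsion_def pow_mult_distrib)
  qed
qed

lemma finite_torsion: "A \<in> \<P> \<Longrightarrow> finite (torsion A p)"
  using finite_part by (simp add: torsion_def)

lemma part_torsion_nontrivial:
  assumes "A \<in> \<P>"
  shows "\<exists>p. prime p \<and> torsion A p \<noteq> {\<one>}"
proof -
  obtain p x where "prime (p::nat)" "x \<in> A" "x \<noteq> \<one>" "x [^] p = \<one>"
    using subgroup_has_prime_order_element[OF part_subgroup finite_part part_nontrivial] assms by metis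
  then have "x \<in> torsion A p" by (simp add: torsion_def)
  then show ?thesis using \<open>prime p\<close> \<open>x \<noteq> \<one>\<close> by blast
qed

lemma conjugate_torsion:
  assumes "A \<in> \<P>" "g \<in> carrier G" "conjugate G g ` A = A" "x \<in> torsion A p"
  shows "conjugate G g x \<in> torsion A p"
  using assms part_carrier[OF assms(1)] by (auto simp: torsion_def conjugate_pow)

text \<open>
  Maximality is what rules out a torsion subgroup that acts like a Frobenius complement, normalizing
  another part without fixing any of its nontrivial elements: in \<open>S\<^sub>3\<close>, the parts of order 2 act so
  on the part of order 3, which is the one with the largest torsion.
\<close>
lemma normalizing_torsion_fixes_element:
  assumes A: "A \<in> \<P>" and B: "B \<in> \<P>" "A \<noteq> B" and p: "prime p"
    and maximal: "\<And>C r. C \<in> \<P> \<Longrightarrow> prime r \<Longrightarrow> card (torsion C r) \<le> card (torsion A p)"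
    and normalizes: "\<And>g. g \<in> torsion A p \<Longrightarrow> conjugate G g ` B = B"
  shows "\<exists>b\<in>B. b \<noteq> \<one> \<and> (\<forall>g\<in>torsion A p. conjugate G g b = b)"
proof (cases "torsion B p = {\<one>}")
  case False
  define Q where "Q = torsion A p"
  define M where "M = {x \<in> torsion B p. \<exists>g\<in>Q. conjugate G g x \<noteq> x}"
  have QG: "g \<in> carrier G" if "g \<in> Q" for g
    using that part_carrier[OF A] by (simp add: Q_def torsion_def)
  have BG: "x \<in> carrier G" if "x \<in> torsion B p" for x
    using that part_carrier[OF B(1)] by (simp add: torsion_def)
  have moved: "p dvd card M"
    unfolding M_def
  proof (rule subgroup_prime_exponent_dvd_card_moved[OF p])
    show "subgroup Q G" "finite Q"
      using torsion_subgroup[OF A] finite_torsion[OF A] by (simp_all add: Q_def)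
    show "g [^] p = \<one>" if "g \<in> Q" for g using that by (simp add: Q_def torsion_def)
    show "finite (torsion B p)" using finite_torsion[OF B(1)] .
    show "conjugate G g x \<in> torsion B p" if "g \<in> Q" "x \<in> torsion B p" for g x
      using conjugate_torsion[OF B(1) QG] normalizes that by (simp add: Q_def)
    show "conjugate G \<one> x = x" if "x \<in> torsion B p" for x
      using that BG by simp
    show "conjugate G (g \<otimes> h) x = conjugate G g (conjugate G h x)"
      if "g \<in> Q" "h \<in> Q" "x \<in> torsion B p" for g h x
      using that QG BG by (simp add: conjugate_by_mult)
  qed
  have all: "p dvd card (torsion B p)"
    using subgroup_prime_exponent_dvd_card[OF p torsion_subgroup[OF B(1)] finite_torsion[OF B(1)]] False
    by (simp add: torsion_def)
  \<comment> \<open>If only \<open>\<one>\<close> were fixed, both \<open>card M\<close> and \<open>card M + 1\<close> would be multiples of \<open>p\<close>.\<close>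
  have "M \<noteq> torsion B p - {\<one>}"
  proof
    assume "M = torsion B p - {\<one>}"
    moreover have "\<one> \<in> torsion B p" using subgroup.one_closed[OF torsion_subgroup[OF B(1)]] .
    ultimately have "card (torsion B p) = Suc (card M)"
      using card.remove[OF finite_torsion[OF B(1)], of \<one> p] by simp
    then have "p dvd 1" using moved all by (metis dvd_add_right_iff Suc_eq_plus1)
    then show False using p by simp
  qed
  moreover have "M \<subseteq> torsion B p - {\<one>}" using QG by (auto simp: M_def)
  ultimately obtain b where "b \<in> torsion B p" "b \<noteq> \<one>" "b \<notin> M" by blast
  then show ?thesis by (auto simp: M_def Q_def torsion_def)
next
  case True
  define Q where "Q = torsion A p"
  have QG: "g \<in> carrier G" if "g \<in> Q" for g
    using that part_carrier[OF A] by (simp add: Q_def torsion_def)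
  obtain r where r: "prime r" "torsion B r \<noteq> {\<one>}" using part_torsion_nontrivial[OF B(1)] by blast
  have one: "\<one> \<in> torsion B r" using subgroup.one_closed[OF torsion_subgroup[OF B(1)]] .
  then obtain x where x: "x \<in> torsion B r" "x \<noteq> \<one>" using r by blast
  then have xB: "x \<in> B" and xG: "x \<in> carrier G"
    using part_carrier[OF B(1)] by (simp_all add: torsion_def)
  have fpf: "g = \<one>" if g: "g \<in> Q" "conjugate G g x = x" for g
  proof (rule ccontr)
    assume "g \<noteq> \<one>"
    moreover have "g \<otimes> x = x \<otimes> g" using g QG xG by (simp add: conjugate_eq_self_iff)
    ultimately have "x [^] p = \<one>"
      using commuting_parts_exponent[OF A _ \<open>g \<noteq> \<one>\<close> B(1) xB B(2)] g(1) by (simp add: Q_def torsion_def)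
    then have "x \<in> torsion B p" using xB by (simp add: torsion_def)
    then show False using True x(2) by simp
  qed
  \<comment> \<open>The orbit of \<open>x\<close> is regular, so \<open>Q\<close> injects into the nontrivial elements of \<open>torsion B r\<close>.\<close>
  have "inj_on (\<lambda>g. conjugate G g x) Q"
  proof (rule inj_onI)
    fix g h assume gh: "g \<in> Q" "h \<in> Q" "conjugate G g x = conjugate G h x"
    interpret Q: subgroup Q G unfolding Q_def using torsion_subgroup[OF A] .
    have "conjugate G (inv h \<otimes> g) x = x"
      using gh QG xG by (simp add: conjugate_by_mult)
    then have "inv h \<otimes> g = \<one>" using fpf gh by simp
    then show "g = h" using gh(1,2) QG by (metis inv_closed inv_equality inv_inv)
  qed
  moreover have "(\<lambda>g. conjugate G g x) ` Q \<subseteq> torsion B r - {\<one>}"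
    using conjugate_torsion[OF B(1) QG _ x(1)] normalizes QG xG x(2) by (auto simp: Q_def)
  ultimately have "card Q \<le> card (torsion B r - {\<one>})"
    using finite_torsion[OF B(1)] by (metis card_inj_on_le finite_Diff)
  also have "\<dots> < card (torsion B r)"
    using one finite_torsion[OF B(1)] by (rule card_Diff1_less[rotated])
  also have "\<dots> \<le> card Q" unfolding Q_def by (rule maximal[OF B(1) r(1)])
  finally show ?thesis by simp
qed

text \<open>
  Let \<open>K\<close> be this set of parts and \<open>C\<close> the centralizer of the torsion subgroup. Counting the elements
  of \<open>C\<close> outside \<open>A\<close> by parts gives
  \<open>card C - card A + card K = (\<Sum>B\<in>K. card (B \<inter> C))\<close>,
  where \<open>p\<close> divides every cardinality except possibly that of \<open>K\<close>.
\<close>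
lemma prime_dvd_card_parts_meeting_centralizer:
  assumes A: "A \<in> \<P>" and p: "prime p" and nontrivial: "torsion A p \<noteq> {\<one>}"
  shows "p dvd card {B \<in> \<P> - {A}. \<exists>b\<in>B. b \<noteq> \<one> \<and> (\<forall>g\<in>torsion A p. conjugate G g b = b)}"
proof -
  define Q where "Q = torsion A p"
  define C where "C = set_centralizer G Q"
  define K where "K = {B \<in> \<P> - {A}. B \<inter> C \<noteq> {\<one>}}"
  have Qsub: "subgroup Q G" unfolding Q_def by (rule torsion_subgroup[OF A])
  have QG: "g \<in> carrier G" if "g \<in> Q" for g using subgroup.mem_carrier[OF Qsub that] .
  have finQ: "finite Q" unfolding Q_def by (rule finite_torsion[OF A])
  have Q_exp: "g [^] p = \<one>" if "g \<in> Q" for g using that by (simp add: Q_def torsion_def)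
  have Csub: "subgroup C G"
    unfolding C_def using QG by (blast intro: set_centralizer_subgroup)
  have C_iff: "x \<in> C \<longleftrightarrow> x \<in> carrier G \<and> (\<forall>g\<in>Q. g \<otimes> x = x \<otimes> g)" for x
    unfolding C_def set_centralizer_def by force
  have AC: "A \<subseteq> C"
    using part_carrier[OF A] part_commute[OF A] by (auto simp: C_iff Q_def torsion_def)
  have finC: "finite C" using finite_carrier by (simp add: C_def set_centralizer_def)
  have dvd_subgroup: "p dvd card S" if S: "subgroup S G" "Q \<subseteq> S" for S
  proof -
    interpret S: group "G\<lparr>carrier := S\<rparr>" using S(1) by (rule subgroup.subgroup_is_group) (rule is_group)
    have "subgroup Q (G\<lparr>carrier := S\<rparr>)" using subgroup_incl[OF Qsub S] .
    then have "card (rcosets\<^bsub>G\<lparr>carrier := S\<rparr>\<^esub> Q) * card Q = card S"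
      using S.lagrange[of Q] by (simp add: order_def)
    then have "card Q dvd card S" by (rule dvdI[OF sym, OF trans[OF mult.commute]])
    moreover have "p dvd card Q"
      using subgroup_prime_exponent_dvd_card[OF p Qsub finQ Q_exp] nontrivial unfolding Q_def by blast
    ultimately show ?thesis using dvd_trans by blast
  qed
  have QA: "Q \<subseteq> A" by (auto simp: Q_def torsion_def)
  have dvd_part: "p dvd card (B \<inter> C)" if B: "B \<in> K" for B
  proof (rule subgroup_prime_exponent_dvd_card[OF p])
    have BP: "B \<in> \<P>" "A \<noteq> B" "B \<inter> C \<noteq> {\<one>}" using B by (auto simp: K_def)
    show "subgroup (B \<inter> C) G" using subgroups_Inter_pair[OF part_subgroup[OF BP(1)] Csub] .
    show "finite (B \<inter> C)" using finC by simp
    show "B \<inter> C \<noteq> {\<one>}" by fact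
    obtain g where g: "g \<in> Q" "g \<noteq> \<one>" using nontrivial subgroup.one_closed[OF Qsub] unfolding Q_def by blast
    show "x [^] p = \<one>" if "x \<in> B \<inter> C" for x
      using commuting_parts_exponent[OF A _ g(2) BP(1) _ BP(2)] that g(1)
      by (auto simp: C_iff Q_def torsion_def)
  qed
  have "C - A = (\<Union>B\<in>K. B \<inter> C - {\<one>})"
  proof
    have "\<one> \<in> A" using subgroup.one_closed[OF part_subgroup[OF A]] .
    show "C - A \<subseteq> (\<Union>B\<in>K. B \<inter> C - {\<one>})"
    proof
      fix x assume x: "x \<in> C - A"
      then obtain B where B: "B \<in> \<P>" "x \<in> B" using parts_cover by (auto simp: C_iff)
      have "x \<noteq> \<one>" using x \<open>\<one> \<in> A\<close> by blast
      then show "x \<in> (\<Union>B\<in>K. B \<inter> C - {\<one>})" using x B by (auto simp: K_def)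
    qed
    show "(\<Union>B\<in>K. B \<inter> C - {\<one>}) \<subseteq> C - A"
      using parts_meet[OF A] by (fastforce simp: K_def)
  qed
  moreover have "card (\<Union>B\<in>K. B \<inter> C - {\<one>}) = (\<Sum>B\<in>K. card (B \<inter> C - {\<one>}))"
  proof (rule card_UN_disjoint)
    show "finite K" using finite_parts by (simp add: K_def)
    show "\<forall>B\<in>K. finite (B \<inter> C - {\<one>})" using finC by blast
    show "\<forall>B\<in>K. \<forall>B'\<in>K. B \<noteq> B' \<longrightarrow> (B \<inter> C - {\<one>}) \<inter> (B' \<inter> C - {\<one>}) = {}"
      using parts_meet unfolding K_def by blast
  qed
  ultimately have "card (C - A) = (\<Sum>B\<in>K. card (B \<inter> C - {\<one>}))" by simp
  then have "card (C - A) + card K = (\<Sum>B\<in>K. card (B \<inter> C - {\<one>}) + 1)"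
    unfolding sum.distrib by simp
  also have "\<dots> = (\<Sum>B\<in>K. card (B \<inter> C))"
  proof (rule sum.cong)
    fix B assume "B \<in> K"
    then have "\<one> \<in> B \<inter> C"
      using subgroup.one_closed[OF part_subgroup] subgroup.one_closed[OF Csub] by (auto simp: K_def)
    then show "card (B \<inter> C - {\<one>}) + 1 = card (B \<inter> C)"
      using card.remove[of "B \<inter> C" \<one>] finC by simp
  qed simp
  finally have sum: "card (C - A) + card K = (\<Sum>B\<in>K. card (B \<inter> C))" .
  have "p dvd card C - card A"
    using dvd_subgroup[OF Csub] dvd_subgroup[OF part_subgroup[OF A]] QA AC by (intro dvd_diff_nat) auto
  then have "p dvd card (C - A)" using AC finite_part[OF A] by (simp add: card_Diff_subset)
  moreover have "p dvd card (C - A) + card K"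
    unfolding sum using dvd_part by (rule dvd_sum)
  ultimately have "p dvd card K" by (simp add: dvd_add_right_iff)
  moreover have "K = {B \<in> \<P> - {A}. \<exists>b\<in>B. b \<noteq> \<one> \<and> (\<forall>g\<in>Q. conjugate G g b = b)}"
  proof -
    have "(B \<inter> C \<noteq> {\<one>}) = (\<exists>b\<in>B. b \<noteq> \<one> \<and> (\<forall>g\<in>Q. conjugate G g b = b))" if "B \<in> \<P>" for B
      using that part_carrier[OF that] QG subgroup.one_closed[OF part_subgroup[OF that]] subgroup.one_closed[OF Csub]
      by (auto simp: C_iff conjugate_eq_self_iff)
    then show ?thesis by (auto simp: K_def)
  qed
  ultimately show ?thesis by (simp add: Q_def)
qed

text \<open>
  With \<open>Q\<close> the largest torsion subgroup, the parts other than \<open>A\<close> split into those that \<open>Q\<close> moves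
  (the set \<open>M\<close>) and those that contain a nontrivial element centralized by \<open>Q\<close> (the set \<open>K\<close>). A part of
  the latter kind is normalized by \<open>Q\<close>, because distinct parts share only \<open>\<one>\<close>.
\<close>
theorem prime_dvd_order_and_card_parts:
  obtains p where "prime p" "p dvd order G" "p dvd card \<P> - 1"
proof -
  define S where "S = {(A, p :: nat). A \<in> \<P> \<and> prime p}"
  have bounded: "\<forall>x. x \<in> S \<longrightarrow> card (torsion (fst x) (snd x)) < Suc (order G)"
  proof (intro allI impI)
    fix x assume "x \<in> S"
    then have "torsion (fst x) (snd x) \<subseteq> carrier G"
      using part_carrier by (auto simp: S_def torsion_def)
    then show "card (torsion (fst x) (snd x)) < Suc (order G)"
      unfolding order_def using finite_carrier by (simp add: card_mono less_Suc_eq_le)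
  qed
  obtain B0 where B0: "B0 \<in> \<P>" using parts_cover[OF one_closed] by blast
  then obtain r where r: "prime r" "torsion B0 r \<noteq> {\<one>}" using part_torsion_nontrivial by blast
  have "(B0, r) \<in> S" using B0 r by (simp add: S_def)
  then obtain x where "x \<in> S" and x_max:
      "\<forall>y. y \<in> S \<longrightarrow> card (torsion (fst y) (snd y)) \<le> card (torsion (fst x) (snd x))"
    using ex_has_greatest_nat[of "\<lambda>x. x \<in> S" "(B0, r)", OF _ bounded] by blast
  then obtain A p where x: "x = (A, p)" and A: "A \<in> \<P>" and p: "prime p" by (auto simp: S_def)
  have maximal: "card (torsion C s) \<le> card (torsion A p)" if "C \<in> \<P>" "prime s" for C s
    using x_max that by (auto simp: S_def x)
  define Q where "Q = torsion A p"
  have Qsub: "subgroup Q G" unfolding Q_def by (rule torsion_subgroup[OF A])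
  have QG: "g \<in> carrier G" if "g \<in> Q" for g using subgroup.mem_carrier[OF Qsub that] .
  have finQ: "finite Q" unfolding Q_def by (rule finite_torsion[OF A])
  have Q_exp: "g [^] p = \<one>" if "g \<in> Q" for g using that by (simp add: Q_def torsion_def)
  have "Q \<noteq> {\<one>}"
  proof
    assume "Q = {\<one>}"
    then have "card (torsion B0 r) \<le> card {\<one>}" using maximal[OF B0 r(1)] by (simp add: Q_def)
    moreover have "{\<one>} \<subseteq> torsion B0 r" using subgroup.one_closed[OF torsion_subgroup[OF B0]] by simp
    ultimately have "{\<one>} = torsion B0 r"
      using finite_torsion[OF B0] by (metis card_seteq)
    then show False using r by blast
  qed
  have fixes_A: "conjugate G g ` A = A" if g: "g \<in> Q" for g
  proof -
    have "g \<in> A" using g by (simp add: Q_def torsion_def)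
    then have "conjugate G g x = x" if "x \<in> A" for x
      using that part_carrier[OF A] part_commute[OF A] by (simp add: conjugate_eq_self_iff)
    then show ?thesis by (simp cong: image_cong)
  qed
  define K where "K = {B \<in> \<P> - {A}. \<exists>b\<in>B. b \<noteq> \<one> \<and> (\<forall>g\<in>Q. conjugate G g b = b)}"
  define M where "M = {B \<in> \<P> - {A}. \<exists>g\<in>Q. conjugate G g ` B \<noteq> B}"
  have comp: "conjugate G (g \<otimes> h) ` B = conjugate G g ` conjugate G h ` B"
    if "g \<in> Q" "h \<in> Q" "B \<in> \<P>" for g h B
    unfolding image_image using that QG part_carrier[OF that(3)]
    by (intro image_cong) (simp_all add: conjugate_by_mult)
  have conj_one: "conjugate G \<one> ` B = B" if "B \<in> \<P>" for B
    using part_carrier[OF that] by (simp cong: image_cong)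
  have "p dvd card M"
    unfolding M_def
  proof (rule subgroup_prime_exponent_dvd_card_moved[OF p Qsub finQ Q_exp])
    show "finite (\<P> - {A})" using finite_parts by simp
    show "conjugate G g ` B \<in> \<P> - {A}" if g: "g \<in> Q" and B: "B \<in> \<P> - {A}" for g B
    proof -
      have "conjugate G g ` B \<noteq> A"
      proof
        assume "conjugate G g ` B = A"
        then have "conjugate G (inv g) ` conjugate G g ` B = conjugate G (inv g) ` A" by simp
        moreover have ig: "inv g \<in> Q" using subgroup.m_inv_closed[OF Qsub g] .
        ultimately have "conjugate G (inv g \<otimes> g) ` B = A" using comp[OF ig g] fixes_A[OF ig] B by simp
        then show False using B QG[OF g] conj_one by simp
      qed
      then show ?thesis using conjugate_part QG g B by blast
    qed
  qed (use comp conj_one in auto)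
  moreover have "p dvd card K"
    unfolding K_def Q_def using prime_dvd_card_parts_meeting_centralizer[OF A p] \<open>Q \<noteq> {\<one>}\<close> by (simp add: Q_def)
  moreover have "\<P> - {A} - M = K"
  proof
    show "\<P> - {A} - M \<subseteq> K"
    proof
      fix B assume "B \<in> \<P> - {A} - M"
      then have B: "B \<in> \<P>" "A \<noteq> B" "\<And>g. g \<in> Q \<Longrightarrow> conjugate G g ` B = B" by (auto simp: M_def)
      then have "\<exists>b\<in>B. b \<noteq> \<one> \<and> (\<forall>g\<in>Q. conjugate G g b = b)"
        unfolding Q_def by (intro normalizing_torsion_fixes_element[OF A B(1,2) p maximal]) auto
      then show "B \<in> K" using B by (auto simp: K_def)
    qed
    show "K \<subseteq> \<P> - {A} - M"
    proof
      fix B assume "B \<in> K"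
      then obtain b where B: "B \<in> \<P>" "B \<noteq> A" and b: "b \<in> B" "b \<noteq> \<one>" "\<And>g. g \<in> Q \<Longrightarrow> conjugate G g b = b"
        by (auto simp: K_def)
      have "conjugate G g ` B = B" if "g \<in> Q" for g
        using parts_meet[OF conjugate_part[OF B(1) QG[OF that]] B(1), of b] b that by (metis imageI)
      then show "B \<in> \<P> - {A} - M" using B by (auto simp: M_def)
    qed
  qed
  ultimately have "p dvd card M + card (\<P> - {A} - M)" by simp
  moreover have "M \<subseteq> \<P> - {A}" by (auto simp: M_def)
  then have "card M + card (\<P> - {A} - M) = card (\<P> - {A})"
    using finite_parts by (metis card_Diff_subset card_mono finite_Diff finite_subset le_add_diff_inverse)
  ultimately have "p dvd card \<P> - 1" using A finite_parts by simp
  moreover have "p dvd order G"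
  proof -
    have "p dvd card Q" using subgroup_prime_exponent_dvd_card[OF p Qsub finQ Q_exp \<open>Q \<noteq> {\<one>}\<close>] .
    then show ?thesis using lagrange[OF Qsub] by (metis dvd_mult)
  qed
  ultimately show thesis using that p by blast
qed

end

section \<open>The partition of the central quotient of an F-group\<close>

lemma (in group) centralizer_eq_set_centralizer: "x \<in> carrier G \<Longrightarrow> centralizer G x = set_centralizer G {x}"
  by (simp add: centralizer_def set_centralizer_def)

lemma (in group) centralizer_eq_carrier_iff:
  assumes "x \<in> carrier G"
  shows "centralizer G x = carrier G \<longleftrightarrow> x \<in> center G"
proof -
  have "centralizer G x = carrier G \<longleftrightarrow> (\<forall>g\<in>carrier G. g \<otimes> x = x \<otimes> g)"
    unfolding centralizer_def by blast
  also have "\<dots> \<longleftrightarrow> (\<forall>g\<in>carrier G. x \<otimes> g = g \<otimes> x)"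
    by (rule ball_cong[OF refl]) (rule eq_commute)
  also have "\<dots> \<longleftrightarrow> x \<in> center G"
    using assms unfolding center_def by blast
  finally show ?thesis .
qed

text \<open>
  As \<open>C = centralizer G x\<close> contains \<open>x\<close>, everything that centralizes \<open>C\<close> lies in \<open>C\<close>, so that
  \<open>set_centralizer G C\<close> is the center of \<open>C\<close>. The part of a coset outside the identity is that of
  its representative's own centralizer, and the F-property makes it unique. Removing
  \<open>carrier G\<close>, the centralizer of the central elements, accounts for the subtracted \<open>1\<close>.
\<close>
lemma F_group_quotient_partition:
  fixes G (structure)
  assumes "F_group G" and nonabelian: "\<not> comm_group G" and fin: "finite (Cent G)"
  defines "\<P> \<equiv> (\<lambda>C. (\<lambda>a. center G #> a) ` set_centralizer G C) ` (Cent G - {carrier G})"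
  shows "normal_abelian_partition (G Mod center G) \<P>" and "card \<P> = card (Cent G) - 1"
proof -
  interpret group G using \<open>F_group G\<close> by (simp add: F_group_def)
  define Z where "Z = center G"
  define h where "h = (\<lambda>a. Z #> a)"
  define cen where "cen = (\<lambda>C. set_centralizer G C)"
  define I where "I = Cent G - {carrier G}"
  have P: "\<P> = (\<lambda>C. h ` cen C) ` I" by (simp add: \<P>_def h_def cen_def I_def Z_def)
  interpret Z: normal Z G unfolding Z_def by (rule center_normal[OF is_group])
  interpret h: group_hom G "G Mod Z" h
    using Z.factorgroup_is_group Z.r_coset_hom_Mod
    by (auto simp: group_hom_def group_hom_axioms_def h_def is_group)
  have I_iff: "C \<in> I \<longleftrightarrow> (\<exists>x. x \<in> carrier G \<and> x \<notin> Z \<and> C = centralizer G x)" for C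
    using centralizer_eq_carrier_iff by (auto simp: I_def Cent_def Z_def)
  have C_carrier: "C \<subseteq> carrier G" if "C \<in> I" for C
    using that by (auto simp: I_iff centralizer_def)
  have cen_sub: "subgroup (cen C) G" if "C \<in> I" for C
    unfolding cen_def using set_centralizer_subgroup[OF C_carrier[OF that]] .
  have Z_cen: "Z \<subseteq> cen C" if "C \<in> I" for C
    using C_carrier[OF that] unfolding Z_def center_def cen_def set_centralizer_def by blast
  have own: "x \<in> cen (centralizer G x)" if "x \<in> carrier G" for x
    using that unfolding cen_def set_centralizer_def centralizer_def by force
  have cen_unique: "C = centralizer G y" if C: "C \<in> I" "y \<in> cen C" "y \<notin> Z" for C y
  proof -
    obtain x where x: "x \<in> carrier G" "x \<notin> Z" "C = centralizer G x" using C(1) I_iff by blast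
    have y: "y \<in> carrier G" using C(2) by (simp add: cen_def set_centralizer_def)
    have "centralizer G x \<subseteq> centralizer G y"
      using C(2) x(3) C_carrier[OF C(1)] unfolding cen_def set_centralizer_def centralizer_def by force
    then show ?thesis using \<open>F_group G\<close> x y C(3) unfolding F_group_def Z_def by blast
  qed
  \<comment> \<open>\<open>cen C\<close> is a union of cosets of \<open>Z\<close>, so membership can be tested in the quotient.\<close>
  have h_mem: "y \<in> cen C" if C: "C \<in> I" and y: "y \<in> carrier G" "h y \<in> h ` cen C" for C y
  proof -
    obtain a where a: "a \<in> cen C" "h y = h a" using y(2) by blast
    have "y \<in> Z #> a" using rcos_self[OF y(1) Z.subgroup_axioms] a(2) by (simp add: h_def)
    then obtain z where "z \<in> Z" "y = z \<otimes> a" by (auto simp: r_coset_def)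
    then show ?thesis using a(1) Z_cen[OF C] subgroup.m_closed[OF cen_sub[OF C]] by blast
  qed
  have h_one: "h y = \<one>\<^bsub>G Mod Z\<^esub> \<longleftrightarrow> y \<in> Z" if "y \<in> carrier G" for y
    using that coset_join1[OF _ that Z.subgroup_axioms] coset_join2[OF that Z.subgroup_axioms]
    by (auto simp: h_def FactGroup_def)
  have h_surj: "\<exists>y\<in>carrier G. q = h y" if "q \<in> carrier (G Mod Z)" for q
    using that by (auto simp: FactGroup_def RCOSETS_def h_def)
  have h_conj: "conjugate (G Mod Z) (h g) (h a) = h (conjugate G g a)"
    if "g \<in> carrier G" "a \<in> carrier G" for g a
    using that by (simp add: conjugate_def)
  have cenG: "a \<in> carrier G" if "a \<in> cen C" for a C using that by (simp add: cen_def set_centralizer_def)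
  obtain u v where uv: "u \<in> carrier G" "v \<in> carrier G" "u \<otimes> v \<noteq> v \<otimes> u"
    using nonabelian group_comm_groupI by blast
  have uvZ: "u \<notin> Z" "v \<notin> Z"
    using uv uv(3)[symmetric] unfolding Z_def center_def by blast+
  have inj: "inj_on (\<lambda>C. h ` cen C) I"
  proof (rule inj_onI)
    fix C D assume CD: "C \<in> I" "D \<in> I" "h ` cen C = h ` cen D"
    obtain x where x: "x \<in> carrier G" "x \<notin> Z" "C = centralizer G x" using CD(1) I_iff by blast
    have "x \<in> cen D" using h_mem[OF CD(2) x(1)] own[OF x(1)] CD(3) x(3) by blast
    then show "C = D" using cen_unique[OF CD(2) _ x(2)] x(3) by simp
  qed
  have "carrier G \<in> Cent G"
    using centralizer_eq_carrier_iff[of \<one>] by (force simp: Cent_def center_def)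
  then show "card \<P> = card (Cent G) - 1"
    using card_image[OF inj] fin by (simp add: P I_def)
  have "normal_abelian_partition (G Mod Z) \<P>"
  proof (intro normal_abelian_partition.intro normal_abelian_partition_axioms.intro)
    show "group (G Mod Z)" by (rule h.H.is_group)
    show "finite \<P>" using fin by (simp add: P I_def)
    show "subgroup A (G Mod Z)" if "A \<in> \<P>" for A
      using that h.subgroup_img_is_subgroup cen_sub by (auto simp: P)
    show "x \<otimes>\<^bsub>G Mod Z\<^esub> y = y \<otimes>\<^bsub>G Mod Z\<^esub> x" if A: "A \<in> \<P>" "x \<in> A" "y \<in> A" for A x y
    proof -
      obtain C a b where C: "C \<in> I" "a \<in> cen C" "b \<in> cen C" "x = h a" "y = h b"
        using A by (auto simp: P)
      obtain c where c: "c \<in> carrier G" "C = centralizer G c" using C(1) I_iff by blast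
      have "c \<in> C" using c by (simp add: centralizer_def)
      then have "a \<in> C" using C(2) c unfolding cen_def set_centralizer_def centralizer_def by blast
      then have "a \<otimes> b = b \<otimes> a"
        using C(3) unfolding cen_def set_centralizer_def by force
      then show ?thesis using C(2-5) cenG by (metis h.hom_mult)
    qed
    show "A \<noteq> {\<one>\<^bsub>G Mod Z\<^esub>}" if A: "A \<in> \<P>" for A
    proof -
      obtain C where C: "C \<in> I" "A = h ` cen C" using A by (auto simp: P)
      then obtain x where x: "x \<in> carrier G" "x \<notin> Z" "C = centralizer G x" using I_iff by blast
      then show ?thesis using C(2) own[OF x(1)] h_one[OF x(1)] by blast
    qed
    show "\<exists>A\<in>\<P>. q \<in> A" if q: "q \<in> carrier (G Mod Z)" for q
    proof -
      obtain y where y: "y \<in> carrier G" "q = h y" using h_surj[OF q] by blast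
      show ?thesis
      proof (cases "y \<in> Z")
        case True
        have "centralizer G u \<in> I" using uv uvZ I_iff by blast
        then show ?thesis using Z_cen True y(2) by (auto simp: P)
      next
        case False
        then have "centralizer G y \<in> I" using y(1) I_iff by blast
        then show ?thesis using own[OF y(1)] y(2) by (auto simp: P)
      qed
    qed
    show "A = B" if AB: "A \<in> \<P>" "B \<in> \<P>" "q \<in> A" "q \<in> B" "q \<noteq> \<one>\<^bsub>G Mod Z\<^esub>" for A B q
    proof -
      obtain C D where C: "C \<in> I" "A = h ` cen C" and D: "D \<in> I" "B = h ` cen D"
        using AB by (auto simp: P)
      obtain y where y: "y \<in> cen C" "q = h y" using AB(3) C(2) by blast
      have yG: "y \<in> carrier G" using cenG[OF y(1)] .
      have "y \<notin> Z" using AB(5) h_one[OF yG] y(2) by simp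
      moreover have "y \<in> cen D" using h_mem[OF D(1) yG] AB(4) D(2) y(2) by simp
      ultimately have "C = D" using cen_unique[OF C(1) y(1)] cen_unique[OF D(1)] by simp
      then show ?thesis using C D by simp
    qed
    show "conjugate (G Mod Z) q ` A \<in> \<P>" if A: "A \<in> \<P>" and q: "q \<in> carrier (G Mod Z)" for A q
    proof -
      obtain g where g: "g \<in> carrier G" "q = h g" using h_surj[OF q] by blast
      obtain C where C: "C \<in> I" "A = h ` cen C" using A by (auto simp: P)
      obtain x where x: "x \<in> carrier G" "x \<notin> Z" "C = centralizer G x" using C(1) I_iff by blast
      define D where "D = centralizer G (conjugate G g x)"
      have D: "D = conjugate G g ` C"
        using conjugate_set_centralizer[OF g(1), of "{x}"] g(1) x(1)
        by (simp add: D_def x(3) centralizer_eq_set_centralizer)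
      have "conjugate G g x \<notin> Z"
      proof
        assume z: "conjugate G g x \<in> Z"
        have "conjugate G (inv g) (conjugate G g x) \<in> Z"
          unfolding conjugate_def[of G "inv g"] using z g(1) by (intro Z.inv_op_closed2) auto
        then show False using x g(1) by simp
      qed
      then have "D \<in> I" using g(1) x(1) unfolding I_iff D_def by (metis conjugate_closed)
      moreover have "conjugate (G Mod Z) q ` A = h ` conjugate G g ` cen C"
        unfolding C(2) g(2) image_image using h_conj[OF g(1)] cenG by (intro image_cong) auto
      moreover have "conjugate G g ` cen C = cen D"
        unfolding D cen_def by (rule conjugate_set_centralizer[OF g(1) C_carrier[OF C(1)]])
      ultimately show ?thesis by (auto simp: P)
    qed
    show "2 \<le> card \<P>"
    proof -
      have "v \<in> centralizer G v" "v \<notin> centralizer G u" using uv by (auto simp: centralizer_def)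
      then have "centralizer G u \<noteq> centralizer G v" by blast
      moreover have "{centralizer G u, centralizer G v} \<subseteq> I" using uv uvZ I_iff by blast
      ultimately have "2 \<le> card I" using fin by (metis I_def card_2_iff card_mono finite_Diff)
      then show ?thesis using card_image[OF inj] by (simp add: P)
    qed
  qed
  then show "normal_abelian_partition (G Mod center G) \<P>" by (simp add: Z_def)
qed

theorem proposition2p7:
  fixes G :: "('a, 'b) monoid_scheme" and n :: nat
  assumes "n > 0"
    and "group G"
    and "\<not> comm_group G"
    and "n_centralizer n G"
    and "F_group G"
  shows "finite (carrier (G Mod center G))
    \<and> gcd (int n - 2) (int (order (G Mod center G))) \<noteq> 1"
proof -
  have fin: "finite (Cent G)" and n: "card (Cent G) = n"
    using \<open>n_centralizer n G\<close> by (simp_all add: n_centralizer_def)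
  define \<P> where "\<P> = (\<lambda>C. (\<lambda>a. center G #>\<^bsub>G\<^esub> a) ` set_centralizer G C) ` (Cent G - {carrier G})"
  have card_P: "card \<P> = n - 1"
    unfolding \<P>_def n[symmetric] by (rule F_group_quotient_partition(2)[OF assms(5,3) fin])
  interpret normal_abelian_partition "G Mod center G" \<P>
    unfolding \<P>_def by (rule F_group_quotient_partition(1)[OF assms(5,3) fin])
  obtain p where p: "prime p" "p dvd order (G Mod center G)" "p dvd card \<P> - 1"
    by (rule prime_dvd_order_and_card_parts)
  have "int (card \<P> - 1) = int n - 2" using card_P parts_ge_2 by simp
  then have "int p dvd int n - 2" using p(3) by (metis of_nat_dvd_iff)
  then have "int p dvd gcd (int n - 2) (int (order (G Mod center G)))" using p(2) by simp
  moreover have "\<not> int p dvd 1" using p(1) not_prime_unit by auto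
  ultimately show ?thesis using finite_carrier by metis
qed

end
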